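(* Let $ABC$ be a triangle and let $E$ and $F$ be ordinary points on the (extended) sides $AC$ and $AB$ respectively, distinct from the vertices of $ABC$. Let $E_0, F_0$ be the midpoints of $AC$ and $AB$; let $A_b, A_c$ be the midpoints of $AE$ and $AF$; and let $M_e, M_f$ be the midpoints of $BE$ and $CF$. Then the triangles $A_bE_0M_e$ and $A_cF_0M_f$ (with vertices corresponding in the listed order) are perspective.
   Context: The plane is the real Euclidean plane extended by the line at infinity $l_\infty$; points not on $l_\infty$ are called ordinary. The triangle $ABC$ is nondegenerate with ordinary vertices. Two triangles $X_1X_2X_3$ and $Y_1Y_2Y_3$ are perspective if the lines $X_1Y_1, X_2Y_2, X_3Y_3$ joining corresponding vertices are concurrent (at an ordinary point, or at a point of $l_\infty$). *)

theory Defs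
  imports "HOL-Analysis.Analysis"
begin

type_synonym point = "real ^ 2"

text \<open>A point of the line at infinity is a direction of lines, i.e. a one-dimensional linear
  subspace of the plane.\<close>

typedef direction = "{D :: point set. subspace D \<and> dim D = 1}"
proof
  show "span {axis 1 1} \<in> {D :: point set. subspace D \<and> dim D = 1}"
    by (simp add: dim_singleton)
qed

datatype ext_point = Ordinary point | Ideal direction

text \<open>Meaningful only for \<open>P \<noteq> Q\<close>: then exactly one direction contains \<open>Q - P\<close>, so the line
  has exactly one ideal point.\<close>

definition ext_line :: "point \<Rightarrow> point \<Rightarrow> ext_point set" where
  "ext_line P Q = Ordinary ` (affine hull {P, Q}) \<union> {Ideal d | d. Q - P \<in> Rep_direction d}"

definition concurrent :: "ext_point set \<Rightarrow> ext_point set \<Rightarrow> ext_point set \<Rightarrow> bool" where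
  "concurrent k l m \<longleftrightarrow> (\<exists>Z. Z \<in> k \<and> Z \<in> l \<and> Z \<in> m)"

definition is_triangle :: "point \<Rightarrow> point \<Rightarrow> point \<Rightarrow> bool" where
  "is_triangle P Q R \<longleftrightarrow> \<not> collinear {P, Q, R}"

text \<open>Both triangles have to be nondegenerate, and corresponding vertices have to be distinct so that
  the joining lines are determined.\<close>

definition perspective ::
  "point \<times> point \<times> point \<Rightarrow> point \<times> point \<times> point \<Rightarrow> bool" where
  "perspective = (\<lambda>(X1, X2, X3) (Y1, Y2, Y3).
     is_triangle X1 X2 X3 \<and> is_triangle Y1 Y2 Y3 \<and>
     X1 \<noteq> Y1 \<and> X2 \<noteq> Y2 \<and> X3 \<noteq> Y3 \<and>
     concurrent (ext_line X1 Y1) (ext_line X2 Y2) (ext_line X3 Y3))"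

end

theory Submission imports Defs begin

text \<open>Put \<open>b = B - A\<close>, \<open>c = C - A\<close>, \<open>E = A + s c\<close> and \<open>F = A + t b\<close>, where \<open>s\<close> and \<open>t\<close> differ from
  \<open>0\<close> and \<open>1\<close>. In the oblique coordinates \<open>(x, y)\<close> that stand for \<open>A + (x/2) b + (y/2) c\<close> the six
  vertices are \<open>A\<^sub>b = (0, s)\<close>, \<open>E\<^sub>0 = (0, 1)\<close>, \<open>M\<^sub>e = (1, s)\<close> and \<open>A\<^sub>c = (t, 0)\<close>, \<open>F\<^sub>0 = (1, 0)\<close>,
  \<open>M\<^sub>f = (t, 1)\<close>, so the joining lines are

  \<open>A\<^sub>b A\<^sub>c: s x + t y = s t\<close>, \<open>M\<^sub>e M\<^sub>f: (1 - s) x + (1 - t) y = 1 - s t\<close>,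
  \<open>E\<^sub>0 F\<^sub>0: x + y = 1\<close>.

  The third equation is the sum of the other two; hence the three lines belong to one pencil. For
  \<open>s \<noteq> t\<close> they meet in \<open>(t (1 - s) / (t - s), s (t - 1) / (t - s))\<close>, and for \<open>s = t\<close>, that is for
  \<open>EF\<close> parallel to \<open>CB\<close>, all three are parallel to \<open>BC\<close> and meet at infinity.

  Both triangles are nondegenerate because each has one side parallel to \<open>AC\<close> and one side parallel
  to \<open>AB\<close>.\<close>

text \<open>Nondegeneracy in the form in which it is used: equality of points can be read off from oblique
  coordinates along two sides of a triangle.\<close>

lemma is_triangle_iff_independent_sides:
  "is_triangle P Q R \<longleftrightarrow>
    (\<forall>x y. x *\<^sub>R (Q - P) + y *\<^sub>R (R - P) = 0 \<longrightarrow> x = 0 \<and> y = 0)"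
    (is "_ \<longleftrightarrow> ?indep")
proof -
  have "collinear {P, Q, R} \<longleftrightarrow> collinear {Q, P, R}"
    by (simp add: insert_commute)
  also have "\<dots> \<longleftrightarrow> collinear {0, Q - P, R - P}"
    by (rule collinear_3) (simp add: NO_MATCH_def)
  also have "\<dots> \<longleftrightarrow> Q - P = 0 \<or> R - P = 0 \<or> (\<exists>k. R - P = k *\<^sub>R (Q - P))"
    by (rule collinear_lemma)
  also have "\<dots> \<longleftrightarrow> \<not> ?indep"
  proof
    assume "Q - P = 0 \<or> R - P = 0 \<or> (\<exists>k. R - P = k *\<^sub>R (Q - P))"
    then consider "Q - P = 0" | k where "R - P = k *\<^sub>R (Q - P)"
      by (metis scaleR_zero_left)
    then show "\<not> ?indep"
    proof cases
      case 1
      then have "1 *\<^sub>R (Q - P) + 0 *\<^sub>R (R - P) = 0"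
        by simp
      then show ?thesis
        using zero_neq_one[where 'a = real] by metis
    next
      case (2 k)
      then have "(- k) *\<^sub>R (Q - P) + 1 *\<^sub>R (R - P) = 0"
        by simp
      then show ?thesis
        using zero_neq_one[where 'a = real] by metis
    qed
  next
    assume "\<not> ?indep"
    then obtain x y where xy: "x *\<^sub>R (Q - P) + y *\<^sub>R (R - P) = 0" "x \<noteq> 0 \<or> y \<noteq> 0"
      by blast
    show "Q - P = 0 \<or> R - P = 0 \<or> (\<exists>k. R - P = k *\<^sub>R (Q - P))"
    proof (cases "y = 0")
      case True
      then show ?thesis
        using xy by simp
    next
      case False
      have "y *\<^sub>R (R - P) = (- x) *\<^sub>R (Q - P)"
        using xy(1) by (simp add: eq_neg_iff_add_eq_0 add.commute)
      then have "(1 / y) *\<^sub>R (y *\<^sub>R (R - P)) = (1 / y) *\<^sub>R ((- x) *\<^sub>R (Q - P))"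
        by simp
      then have "R - P = (- x / y) *\<^sub>R (Q - P)"
        using False by simp
      then show ?thesis
        by blast
    qed
  qed
  finally show ?thesis
    unfolding is_triangle_def by blast
qed

lemma is_triangle_of_parallel_sides:
  assumes "is_triangle P Q R"
    and "Y - X = k *\<^sub>R (Q - P)" "k \<noteq> 0"
    and "Z - X = l *\<^sub>R (R - P)" "l \<noteq> 0"
  shows "is_triangle X Y Z"
  using assms by (fastforce simp: is_triangle_iff_independent_sides)

lemma Ordinary_in_ext_line_iff:
  "Ordinary Z \<in> ext_line P Q \<longleftrightarrow> (\<exists>u. Z = P + u *\<^sub>R (Q - P))"
  by (auto simp: ext_line_def affine_hull_2_alt)

lemma Ideal_in_ext_line_iff:
  "Ideal d \<in> ext_line P Q \<longleftrightarrow> Q - P \<in> Rep_direction d"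
  by (auto simp: ext_line_def)

text \<open>All multiples at once, since parallel lines are given by direction vectors of different lengths
  but have to share one point at infinity.\<close>

lemma ex_direction_of_multiples:
  fixes v :: point
  assumes "v \<noteq> 0"
  shows "\<exists>d. \<forall>k. k *\<^sub>R v \<in> Rep_direction d"
proof
  have "Rep_direction (Abs_direction (span {v})) = span {v}"
    using assms by (intro Abs_direction_inverse) (simp add: dim_singleton)
  then show "\<forall>k. k *\<^sub>R v \<in> Rep_direction (Abs_direction (span {v}))"
    by (simp add: span_mul span_base)
qed

theorem theorem2p3:
  fixes A B C E F E0 F0 Ab Ac Me Mf :: "point"
  assumes "is_triangle A B C"
    and "Ordinary E \<in> ext_line A C" and "E \<notin> {A, B, C}"
    and "Ordinary F \<in> ext_line A B" and "F \<notin> {A, B, C}"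
    and "E0 = midpoint A C" and "F0 = midpoint A B"
    and "Ab = midpoint A E" and "Ac = midpoint A F"
    and "Me = midpoint B E" and "Mf = midpoint C F"
  shows "perspective (Ab, E0, Me) (Ac, F0, Mf)"
proof -
  define b c where "b = B - A" and "c = C - A"
  define pt where "pt x y = A + (x / 2) *\<^sub>R b + (y / 2) *\<^sub>R c" for x y
  have indep: "x = 0 \<and> y = 0" if "x *\<^sub>R b + y *\<^sub>R c = 0" for x y
    using assms(1) that by (simp add: is_triangle_iff_independent_sides b_def c_def)
  have pt_diff: "pt x' y' - pt x y = ((x' - x) / 2) *\<^sub>R b + ((y' - y) / 2) *\<^sub>R c" for x y x' y'
    by (simp add: pt_def algebra_simps diff_divide_distrib)
  have pt_eq: "pt x y = pt x' y' \<longleftrightarrow> x = x' \<and> y = y'" for x y x' y'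
    using pt_diff[of x y x' y'] indep[of "(x - x') / 2" "(y - y') / 2"] by auto
  obtain s where s: "E = A + s *\<^sub>R c"
    using assms(2) by (auto simp: Ordinary_in_ext_line_iff c_def)
  obtain t where t: "F = A + t *\<^sub>R b"
    using assms(4) by (auto simp: Ordinary_in_ext_line_iff b_def)
  have st: "s \<noteq> 0" "s \<noteq> 1" "t \<noteq> 0" "t \<noteq> 1"
    using assms(3,5) s t by (auto simp: b_def c_def)
  have B: "B = A + b" and C: "C = A + c"
    by (simp_all add: b_def c_def)
  \<comment> \<open>In \<open>pt\<close> the origin \<open>A\<close> has coefficient \<open>1\<close>; splitting it in halves lets the two sides match.\<close>
  have half: "A = (1/2) *\<^sub>R A + (1/2) *\<^sub>R A"
    by (simp flip: scaleR_left_distrib)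
  have coords: "Ab = pt 0 s" "E0 = pt 0 1" "Me = pt 1 s" "Ac = pt t 0" "F0 = pt 1 0" "Mf = pt t 1"
    unfolding assms(6-11) s t B C pt_def midpoint_def
    by (subst (3) half; simp add: algebra_simps)+

  have "is_triangle A C B"
    using assms(1) by (simp add: is_triangle_def insert_commute)
  then have "is_triangle Ab E0 Me"
    by (rule is_triangle_of_parallel_sides[where k = "(1 - s) / 2" and l = "1 / 2"])
      (use st in \<open>auto simp: coords pt_diff simp flip: b_def c_def\<close>)
  moreover have "is_triangle Ac F0 Mf"
    using assms(1)
    by (rule is_triangle_of_parallel_sides[where k = "(1 - t) / 2" and l = "1 / 2"])
      (use st in \<open>auto simp: coords pt_diff simp flip: b_def c_def\<close>)
  moreover have "Ab \<noteq> Ac" "E0 \<noteq> F0" "Me \<noteq> Mf"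
    using st by (auto simp: coords pt_eq)
  moreover have "concurrent (ext_line Ab Ac) (ext_line E0 F0) (ext_line Me Mf)"
  proof (cases "s = t")
    case True
    have "b - c \<noteq> 0"
      using indep[of 1 "- 1"] by auto
    then obtain d where d: "\<And>k. k *\<^sub>R (b - c) \<in> Rep_direction d"
      using ex_direction_of_multiples by blast
    have "Ac - Ab = (t / 2) *\<^sub>R (b - c)" "F0 - E0 = (1 / 2) *\<^sub>R (b - c)"
      "Mf - Me = ((t - 1) / 2) *\<^sub>R (b - c)"
      using True by (simp_all add: coords pt_diff algebra_simps diff_divide_distrib)
    then have "Ideal d \<in> ext_line Ab Ac" "Ideal d \<in> ext_line E0 F0" "Ideal d \<in> ext_line Me Mf"
      by (simp_all only: Ideal_in_ext_line_iff d)
    then show ?thesis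
      unfolding concurrent_def by blast
  next
    case False
    have on_line: "Ordinary (pt x y) \<in> ext_line (pt x1 y1) (pt x2 y2)"
      if "x = x1 + u * (x2 - x1)" "y = y1 + u * (y2 - y1)" for x y x1 y1 x2 y2 u
      unfolding Ordinary_in_ext_line_iff pt_diff
      by (rule exI[of _ u]) (simp add: that pt_def algebra_simps add_divide_distrib diff_divide_distrib)
    define x y where "x = t * (1 - s) / (t - s)" and "y = s * (t - 1) / (t - s)"
    have "Ordinary (pt x y) \<in> ext_line Ab Ac"
      unfolding coords
      by (rule on_line[where u = "(1 - s) / (t - s)"])
        (use False in \<open>simp_all add: x_def y_def field_simps\<close>)
    moreover have "Ordinary (pt x y) \<in> ext_line E0 F0"
      unfolding coords
      by (rule on_line[where u = x])
        (use False in \<open>simp_all add: x_def y_def field_simps\<close>)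
    moreover have "Ordinary (pt x y) \<in> ext_line Me Mf"
      unfolding coords
      by (rule on_line[where u = "s / (s - t)"])
        (use False in \<open>simp_all add: x_def y_def field_simps\<close>)
    ultimately show ?thesis
      unfolding concurrent_def by blast
  qed
  ultimately show ?thesis
    by (simp add: perspective_def)
qed

end
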